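(* Let $n\geq 3$, let $K\subset\mathbb{C}^n$ be a convex body and let $x_0$ be an interior point of $K$. If for every complex affine hyperplane $H$ through $x_0$ the section $H\cap K$ is symmetric, then $K$ is symmetric.
   Context: A convex body is a compact convex subset of $\mathbb{C}^n$ with nonempty interior. $\mathbb{S}^1=\{\xi\in\mathbb{C}:|\xi|=1\}$. A set $A\subset\mathbb{C}^n$ is called symmetric if there is a translated copy $A'=A-x_0$ of $A$ such that $\xi A'=A'$ for every $\xi\in\mathbb{S}^1$; $x_0$ is then called the center of symmetry of $A$ (the empty set is also regarded as symmetric). *)

theory Defs
  imports "HOL-Analysis.Analysis"
begin

definition convex_body :: "(complex ^ 'n) set \<Rightarrow> bool" where
  "convex_body K \<longleftrightarrow> compact K \<and> convex K \<and> interior K \<noteq> {}"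

text \<open>A is symmetric: some translate A - c is invariant under multiplication by every
  unimodular complex scalar (the empty set is symmetric automatically).\<close>
definition circ_symmetric :: "(complex ^ 'n) set \<Rightarrow> bool" where
  "circ_symmetric A \<longleftrightarrow>
     (\<exists>c. \<forall>\<xi>::complex. cmod \<xi> = 1 \<longrightarrow>
          (\<lambda>x. \<xi> *s x) ` ((\<lambda>x. x - c) ` A) = (\<lambda>x. x - c) ` A)"

definition complex_affine_hyperplane :: "(complex ^ 'n) set \<Rightarrow> bool" where
  "complex_affine_hyperplane H \<longleftrightarrow>
     (\<exists>a b. a \<noteq> 0 \<and> H = {x. (\<Sum>i\<in>UNIV. a $ i * x $ i) = b})"

end

theory Submission
  imports Defs "HOL-Complex_Analysis.Cauchy_Integral_Formula"
begin

text \<open>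
  For every complex linear functional f, the image f(K) is a disc, because two points of K at
  which f realises the diameter of f(K) lie, as n \<ge> 3, on a common hyperplane through x0.
  Let g(f) be the centre and r(f) the radius of this disc. The section realising the disc provides
  a centre p and a vector v such that K contains the circle of all p + \<xi> v, with f(p) = g(f) and
  f(v) = r(f). Testing this circle against another functional k gives
  |k(p) - g(k)| \<le> r(k) - Re k(v), with equality at k = f. On a complex line of functionals
  the restriction G of g therefore has, up to the error made by a supporting affine function of the
  convex function r, a complex linear first order expansion. Summed over a fine triangular grid
  these errors telescope, so the integrals of G over triangles vanish and G is entire by Morera's
  theorem; having linear growth, G is affine. Hence g is linear, that is, g(f) = f(c) for a point c,
  and by separation K is symmetric about c.
\<close>

section \<open>Riemann sums of contour integrals along segments\<close>

lemma linepath_integral_approx: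
  fixes G :: "complex \<Rightarrow> complex"
  assumes lip: "\<And>z w. cmod (G w - G z) \<le> L * cmod (w - z)"
    and cont: "continuous_on UNIV G"
  shows "cmod (contour_integral (linepath u (u + h)) G - h * G u) \<le> L * cmod h * cmod h"
proof -
  have cg: "G contour_integrable_on linepath u (u + h)"
    by (rule contour_integrable_continuous_linepath) (rule continuous_on_subset[OF cont], simp)
  have L: "0 \<le> L" using lip[of 1 0] by (simp, meson norm_ge_zero order_trans)
  have "((\<lambda>x. G x - G u) has_contour_integral
          (contour_integral (linepath u (u + h)) G - G u * ((u + h) - u))) (linepath u (u + h))"
    by (intro has_contour_integral_diff has_contour_integral_integral cg has_contour_integral_const_linepath)
  then have "cmod (contour_integral (linepath u (u + h)) G - G u * ((u + h) - u))
      \<le> (L * cmod h) * cmod ((u + h) - u)"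
  proof (rule has_contour_integral_bound_linepath)
    fix x assume "x \<in> closed_segment u (u + h)"
    then have "cmod (x - u) \<le> cmod h"
      using segment_bound(1)[of x u "u + h"] by simp
    then show "cmod (G x - G u) \<le> L * cmod h"
      using lip[of x u] L by (meson mult_left_mono order_trans)
  qed (use L in auto)
  then show ?thesis by (simp add: mult.commute)
qed

text \<open>Each of the \<open>n\<close> pieces costs \<open>L * cmod h * cmod h\<close>, so for a
  fixed segment \<open>n * h\<close> the total error is of order \<open>1 / n\<close>.\<close>

lemma linepath_riemann_sum:
  fixes G :: "complex \<Rightarrow> complex"
  assumes lip: "\<And>z w. cmod (G w - G z) \<le> L * cmod (w - z)"
    and cont: "continuous_on UNIV G"
  shows "cmod (contour_integral (linepath u (u + of_nat n * h)) G - (\<Sum>j<n. h * G (u + of_nat j * h)))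
          \<le> of_nat n * (L * cmod h * cmod h)"
proof (induction n)
  case 0
  have "linepath u u = (\<lambda>_. u)" by (simp add: fun_eq_iff linepath_def algebra_simps)
  then show ?case using contour_integral_trivial[of u G] by simp
next
  case (Suc n)
  let ?m = "u + of_nat n * h"
  have "contour_integral (linepath u (u + of_nat (Suc n) * h)) G =
      contour_integral (linepath u ?m) G + contour_integral (linepath ?m (u + of_nat (Suc n) * h)) G"
  proof (rule contour_integral_split_linepath)
    show "?m \<in> closed_segment u (u + of_nat (Suc n) * h)"
      unfolding in_segment
      by (intro exI[of _ "real n / real (Suc n)"])
        (simp add: scaleR_conv_of_real field_simps del: of_nat_Suc)
  qed (rule continuous_on_subset[OF cont], simp)
  moreover have "u + of_nat (Suc n) * h = ?m + h" by (simp add: algebra_simps)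
  ultimately have "contour_integral (linepath u (u + of_nat (Suc n) * h)) G
        - (\<Sum>j<Suc n. h * G (u + of_nat j * h))
      = (contour_integral (linepath u ?m) G - (\<Sum>j<n. h * G (u + of_nat j * h)))
        + (contour_integral (linepath ?m (?m + h)) G - h * G ?m)"
    by (simp add: add.assoc)
  also have "cmod \<dots> \<le> of_nat n * (L * cmod h * cmod h) + L * cmod h * cmod h"
    by (intro norm_triangle_le add_mono Suc.IH linepath_integral_approx[OF lip cont])
  finally show ?case by (simp add: algebra_simps)
qed

section \<open>Affinity of functions whose expansion error is controlled by convexity\<close>

lemma triangle_sum_swap:
  fixes f :: "nat \<Rightarrow> nat \<Rightarrow> 'a :: comm_monoid_add"
  shows "(\<Sum>j<N. \<Sum>i<N - j. f i j) = (\<Sum>i<N. \<Sum>j<N - i. f i j)"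
proof -
  have "(\<Sum>j<N. \<Sum>i<N - j. f i j) = (\<Sum>j<N. \<Sum>i\<in>{i \<in> {..<N}. i + j < N}. f i j)"
    by (intro sum.cong) auto
  also have "\<dots> = (\<Sum>i<N. \<Sum>j\<in>{j \<in> {..<N}. i + j < N}. f i j)"
    by (rule sum.swap_restrict) auto
  also have "\<dots> = (\<Sum>i<N. \<Sum>j<N - i. f i j)"
    by (intro sum.cong) auto
  finally show ?thesis .
qed

text \<open>The right side of \<open>control\<close> is the gap between \<open>R\<close> and a
  supporting affine function at \<open>z\<close>, so \<open>b z\<close> acts as a subgradient of
  \<open>R\<close>, and \<open>a z\<close> is the candidate derivative of \<open>G\<close>. In the
  application \<open>G\<close> and \<open>R\<close> are the centre and radius along a complex line
  of functionals.\<close>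

locale convex_controlled =
  fixes G a b :: "complex \<Rightarrow> complex" and R :: "complex \<Rightarrow> real" and M :: real
  assumes control: "\<And>z w. cmod (G w - G z - (w - z) * a z) \<le> R w - R z - Re ((w - z) * b z)"
    and a_bound: "\<And>z. cmod (a z) \<le> M"
    and b_bound: "\<And>z. cmod (b z) \<le> M"
begin

text \<open>Adding \<open>control\<close> at \<open>z\<close> to the nonnegativity of its right side
  with \<open>z\<close> and \<open>z + h\<close> exchanged eliminates \<open>R\<close>. What is left
  is an increment of \<open>b\<close>, which telescopes along equal steps.\<close>

lemma remainder_le: "cmod (G (z + h) - G z - h * a z) \<le> Re (h * (b (z + h) - b z))"
proof -
  have "cmod (G (z + h) - G z - h * a z) \<le> R (z + h) - R z - Re (h * b z)"
    using control[of "z + h" z] by simp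
  moreover have "0 \<le> R z - R (z + h) + Re (h * b (z + h))"
    using order_trans[OF norm_ge_zero control[of z "z + h"]] by simp
  ultimately show ?thesis by (simp add: algebra_simps)
qed

lemma M_nonneg: "0 \<le> M"
  using order_trans[OF norm_ge_zero a_bound] .

lemma Re_diff_le: "Re (h * (b w - b z)) \<le> cmod h * (2 * M)"
proof -
  have "Re (h * (b w - b z)) \<le> cmod h * cmod (b w - b z)"
    by (metis complex_Re_le_cmod norm_mult)
  also have "\<dots> \<le> cmod h * (2 * M)"
    using norm_triangle_le_diff[of "b w" "b z" "2 * M"] b_bound[of w] b_bound[of z]
    by (intro mult_left_mono) auto
  finally show ?thesis .
qed

lemma lipschitz: "cmod (G w - G z) \<le> 3 * M * cmod (w - z)"
proof -
  have "cmod (G w - G z - (w - z) * a z) \<le> cmod (w - z) * (2 * M)"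
    using remainder_le[of z "w - z"] Re_diff_le[of "w - z" w z] by simp
  moreover have "cmod ((w - z) * a z) \<le> cmod (w - z) * M"
    by (simp add: norm_mult mult_left_mono a_bound)
  ultimately have "cmod ((G w - G z - (w - z) * a z) + (w - z) * a z)
      \<le> cmod (w - z) * (2 * M) + cmod (w - z) * M"
    by (intro norm_triangle_le add_mono)
  then show ?thesis by (simp add: algebra_simps)
qed

lemma continuous: "continuous_on UNIV G"
proof (rule lipschitz_on_continuous_on)
  show "(3 * M)-lipschitz_on UNIV G"
    using lipschitz M_nonneg by (intro lipschitz_onI) (auto simp: dist_norm)
qed

text \<open>By telescoping, the bound does not grow with the number \<open>n\<close> of steps. Hence
  the errors over the whole grid, weighted by the other step, vanish in the limit.\<close>

lemma row_remainder_le: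
  "(\<Sum>i<n. cmod (G (u + of_nat (Suc i) * h) - G (u + of_nat i * h) - h * a (u + of_nat i * h)))
     \<le> cmod h * (2 * M)"
proof -
  let ?u = "\<lambda>i. u + of_nat i * h"
  have "(\<Sum>i<n. cmod (G (?u (Suc i)) - G (?u i) - h * a (?u i)))
      \<le> (\<Sum>i<n. Re (h * b (?u (Suc i))) - Re (h * b (?u i)))"
  proof (rule sum_mono)
    fix i
    have "?u (Suc i) = ?u i + h" by (simp add: algebra_simps)
    then show "cmod (G (?u (Suc i)) - G (?u i) - h * a (?u i))
        \<le> Re (h * b (?u (Suc i))) - Re (h * b (?u i))"
      using remainder_le[of "?u i" h] by (simp only: right_diff_distrib minus_complex.sel)
  qed
  also have "\<dots> = Re (h * (b (?u n) - b (?u 0)))"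
    by (subst sum_lessThan_telescope) (simp add: right_diff_distrib)
  also have "\<dots> \<le> cmod h * (2 * M)" by (rule Re_diff_le)
  finally show ?thesis .
qed

text \<open>The three sums discretise the integral of \<open>G\<close> along \<open>u\<close>,
  \<open>u + A\<close>, \<open>u + B\<close>, \<open>u\<close>. They arise by summing
  \<open>k\<close> times the \<open>h\<close>-increments of \<open>G\<close> by rows and
  \<open>h\<close> times the \<open>k\<close>-increments by columns over the triangular
  grid.\<close>

lemma triangle_riemann_sum:
  assumes "A = of_nat N * h" "B = of_nat N * k"
  shows "cmod ((\<Sum>j<N. h * G (u + of_nat j * h)) + (\<Sum>j<N. (k - h) * G (u + A + of_nat j * (k - h)))
      - (\<Sum>j<N. k * G (u + of_nat j * k)) + h * (G (u + A) - G (u + B)))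
    \<le> of_nat N * (4 * M * cmod h * cmod k)"
proof -
  define z where "z i j = u + of_nat i * h + of_nat j * k" for i j :: nat
  define P where "P j = u + A + of_nat j * (k - h)" for j :: nat
  have zP: "z (N - j) j = P j" if "j \<le> N" for j
    using that by (simp add: z_def P_def assms of_nat_diff algebra_simps)
  \<comment> \<open>Both errors use the same slope \<open>a (z i j)\<close>, so it cancels in
    \<open>k * eh i j - h * ek i j\<close>.\<close>
  define eh where "eh i j = G (z (Suc i) j) - G (z i j) - h * a (z i j)" for i j
  define ek where "ek i j = G (z i (Suc j)) - G (z i j) - k * a (z i j)" for i j
  have eh: "(\<Sum>i<n. cmod (eh i j)) \<le> cmod h * (2 * M)" for n j
    using row_remainder_le[of "u + of_nat j * k" h n] by (simp add: eh_def z_def ac_simps)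
  have ek: "(\<Sum>j<n. cmod (ek i j)) \<le> cmod k * (2 * M)" for n i
    using row_remainder_le[of "u + of_nat i * h" k n] by (simp add: ek_def z_def ac_simps)
  have rows: "(\<Sum>i<N - j. G (z (Suc i) j) - G (z i j)) = G (P j) - G (u + of_nat j * k)"
    if "j < N" for j
    using that by (subst sum_lessThan_telescope[of "\<lambda>i. G (z i j)"]) (simp add: zP, simp add: z_def)
  have cols: "(\<Sum>j<N - i. G (z i (Suc j)) - G (z i j)) = G (P (N - i)) - G (u + of_nat i * h)"
    if "i < N" for i
    using that zP[of "N - i"]
    by (subst sum_lessThan_telescope[of "\<lambda>j. G (z i j)"]) (simp, simp add: z_def)
  \<comment> \<open>Rows end at \<open>P 0\<close>, ..., \<open>P (N - 1)\<close> but columns at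
    \<open>P 1\<close>, ..., \<open>P N\<close>. This shift by one produces the corner term with
    \<open>G (u + A)\<close> and \<open>G (u + B)\<close>.\<close>
  have rev: "(\<Sum>i<N. G (P (N - i))) = (\<Sum>j<N. G (P j)) + (G (u + B) - G (u + A))"
  proof -
    have "(\<Sum>i<N. G (P (N - i))) = (\<Sum>j<N. G (P (Suc j)))"
      by (subst sum.nat_diff_reindex[symmetric]) (intro sum.cong, auto simp: Suc_diff_Suc)
    also have "\<dots> - (\<Sum>j<N. G (P j)) = G (P N) - G (P 0)"
      by (simp add: sum_lessThan_telescope[of "\<lambda>j. G (P j)"] flip: sum_subtractf)
    finally show ?thesis
      by (simp add: P_def assms algebra_simps)
  qed
  have "(\<Sum>j<N. \<Sum>i<N - j. k * eh i j - h * ek i j)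
      = (\<Sum>j<N. \<Sum>i<N - j. k * (G (z (Suc i) j) - G (z i j)) - h * (G (z i (Suc j)) - G (z i j)))"
    by (intro sum.cong) (auto simp: eh_def ek_def algebra_simps)
  also have "\<dots> = (\<Sum>j<N. \<Sum>i<N - j. k * (G (z (Suc i) j) - G (z i j)))
      - (\<Sum>i<N. \<Sum>j<N - i. h * (G (z i (Suc j)) - G (z i j)))"
    by (simp only: sum_subtractf triangle_sum_swap[of "\<lambda>i j. h * (G (z i (Suc j)) - G (z i j))"])
  also have "\<dots> = (\<Sum>j<N. k * (G (P j) - G (u + of_nat j * k)))
      - (\<Sum>i<N. h * (G (P (N - i)) - G (u + of_nat i * h)))"
    by (simp add: rows cols flip: sum_distrib_left)
  also have "\<dots> = (\<Sum>j<N. h * G (u + of_nat j * h)) + (\<Sum>j<N. (k - h) * G (P j))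
      - (\<Sum>j<N. k * G (u + of_nat j * k)) + h * (G (u + A) - G (u + B))"
    by (simp add: sum_subtractf rev algebra_simps flip: sum_distrib_left)
  finally have eq: "(\<Sum>j<N. h * G (u + of_nat j * h)) + (\<Sum>j<N. (k - h) * G (P j))
      - (\<Sum>j<N. k * G (u + of_nat j * k)) + h * (G (u + A) - G (u + B))
      = (\<Sum>j<N. \<Sum>i<N - j. k * eh i j - h * ek i j)" ..
  have "cmod (\<Sum>j<N. \<Sum>i<N - j. k * eh i j - h * ek i j)
      \<le> (\<Sum>j<N. \<Sum>i<N - j. cmod k * cmod (eh i j) + cmod h * cmod (ek i j))"
    by (intro sum_norm_le) (metis norm_mult norm_triangle_ineq4)
  also have "\<dots> = (\<Sum>j<N. cmod k * (\<Sum>i<N - j. cmod (eh i j)))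
      + (\<Sum>i<N. cmod h * (\<Sum>j<N - i. cmod (ek i j)))"
    by (simp only: sum.distrib sum_distrib_left triangle_sum_swap[of "\<lambda>i j. cmod h * cmod (ek i j)"])
  also have "\<dots> \<le> (\<Sum>j<N. cmod k * (cmod h * (2 * M))) + (\<Sum>i<N. cmod h * (cmod k * (2 * M)))"
    by (intro add_mono sum_mono mult_left_mono eh ek) auto
  also have "\<dots> = of_nat N * (4 * M * cmod h * cmod k)"
    by (simp add: algebra_simps)
  finally show ?thesis unfolding eq[unfolded P_def] .
qed

lemma triangle_integral_zero:
  "contour_integral (linepath x y) G + contour_integral (linepath y w) G + contour_integral (linepath w x) G = 0"
  (is "?I = 0")
proof -
  define A B where "A = y - x" and "B = w - x"
  \<comment> \<open>The terms are the Riemann errors of the three sides, the grid error and the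
    corner term. With steps \<open>A / N\<close> and \<open>B / N\<close> each is its share of
    \<open>C\<close> divided by \<open>N\<close>.\<close>
  define C where "C = 3 * M * (cmod A * cmod A) + 3 * M * (cmod (B - A) * cmod (B - A))
      + 3 * M * (cmod B * cmod B) + 4 * M * cmod A * cmod B + cmod A * cmod (G y - G w)"
  have bound: "cmod ?I \<le> C / real N" if N: "N > 0" for N :: nat
  proof -
    define h k where "h = A / of_nat N" and "k = B / of_nat N"
    have hk: "A = of_nat N * h" "B = of_nat N * k" using N by (auto simp: h_def k_def)
    have ends: "x + of_nat N * h = y" "y + of_nat N * (k - h) = w" "x + of_nat N * k = w"
        "x + A = y" "x + B = w"
      using hk by (auto simp: A_def B_def algebra_simps)
    let ?S1 = "\<Sum>j<N. h * G (x + of_nat j * h)"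
    let ?S2 = "\<Sum>j<N. (k - h) * G (y + of_nat j * (k - h))"
    let ?S3 = "\<Sum>j<N. k * G (x + of_nat j * k)"
    note rs = linepath_riemann_sum[OF lipschitz continuous]
    have 1: "cmod (contour_integral (linepath x y) G - ?S1) \<le> of_nat N * (3 * M * cmod h * cmod h)"
      using rs[of x N h] by (simp only: ends)
    have 2: "cmod (contour_integral (linepath y w) G - ?S2)
        \<le> of_nat N * (3 * M * cmod (k - h) * cmod (k - h))"
      using rs[of y N "k - h"] by (simp only: ends)
    have 3: "cmod (?S3 - contour_integral (linepath x w) G) \<le> of_nat N * (3 * M * cmod k * cmod k)"
      using rs[of x N k] by (simp only: ends norm_minus_commute)
    have 4: "cmod (?S1 + ?S2 - ?S3 + h * (G y - G w)) \<le> of_nat N * (4 * M * cmod h * cmod k)"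
      using triangle_riemann_sum[OF hk, of x] by (simp only: ends)
    have "contour_integral (linepath w x) G = - contour_integral (linepath x w) G"
      by (rule contour_integral_reverse_linepath) (rule continuous_on_subset[OF continuous], simp)
    then have "?I = (contour_integral (linepath x y) G - ?S1) + (contour_integral (linepath y w) G - ?S2)
        + (?S3 - contour_integral (linepath x w) G) + (?S1 + ?S2 - ?S3 + h * (G y - G w))
        + (- (h * (G y - G w)))"
      by simp
    also have "cmod \<dots> \<le> of_nat N * (3 * M * cmod h * cmod h)
        + of_nat N * (3 * M * cmod (k - h) * cmod (k - h)) + of_nat N * (3 * M * cmod k * cmod k)
        + of_nat N * (4 * M * cmod h * cmod k) + cmod h * cmod (G y - G w)"
      by (intro norm_triangle_le add_mono 1 2 3 4) (simp add: norm_mult)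
    also have "k - h = (B - A) / of_nat N" by (simp add: h_def k_def diff_divide_distrib)
    finally show ?thesis
      using N by (simp add: C_def h_def k_def norm_divide add_divide_distrib)
  qed
  have "(\<lambda>N. C / real N) \<longlonglongrightarrow> 0"
    by (rule lim_const_over_n)
  then have "cmod ?I \<le> 0"
    by (rule tendsto_lowerbound) (use bound in \<open>auto intro!: eventually_sequentiallyI[of 1]\<close>)
  then show ?thesis by simp
qed

lemma affine: "\<exists>\<beta>. \<forall>z. G z = G 0 + z * \<beta>"
proof -
  have "G analytic_on UNIV"
    by (rule Morera_triangle[OF continuous]) (auto simp: triangle_integral_zero)
  then have hol: "G holomorphic_on UNIV" by (simp add: analytic_imp_holomorphic)
  have growth: "cmod (G z) \<le> (cmod (G 0) + 3 * M) * cmod z ^ 1" if "1 \<le> cmod z" for z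
  proof -
    have "cmod (G z) \<le> cmod (G 0) + cmod (G z - G 0)"
      using norm_triangle_sub by blast
    also have "\<dots> \<le> cmod (G 0) * cmod z + 3 * M * cmod z"
      using lipschitz[of z 0] mult_left_mono[OF that, of "cmod (G 0)"] by simp
    finally show ?thesis by (simp add: algebra_simps)
  qed
  have "G z = G 0 + z * deriv G 0" for z
    using Liouville_polynomial[OF hol growth, where \<xi> = z] by simp
  then show ?thesis by blast
qed

end

section \<open>Complex linear functionals\<close>

definition cdot :: "complex ^ 'n \<Rightarrow> complex ^ 'n \<Rightarrow> complex" where
  "cdot a x = (\<Sum>i\<in>UNIV. a $ i * x $ i)"

lemma cdot_add_left: "cdot (a + b) x = cdot a x + cdot b x"
  and cdot_add_right: "cdot a (x + y) = cdot a x + cdot a y"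
  and cdot_diff_right: "cdot a (x - y) = cdot a x - cdot a y"
  and cdot_smult_left: "cdot (c *s a) x = c * cdot a x"
  and cdot_smult_right: "cdot a (c *s x) = c * cdot a x"
  by (simp_all add: cdot_def algebra_simps sum.distrib sum_subtractf sum_distrib_left)

lemma cdot_zero_left [simp]: "cdot 0 x = 0"
  by (simp add: cdot_def)

lemma continuous_on_cdot [continuous_intros]:
  "continuous_on S f \<Longrightarrow> continuous_on S (\<lambda>x. cdot a (f x))"
  unfolding cdot_def by (intro continuous_intros)

lemma cmod_cdot_le: "cmod (cdot a x) \<le> (\<Sum>i\<in>UNIV. cmod (a $ i)) * norm x"
proof -
  have "cmod (cdot a x) \<le> (\<Sum>i\<in>UNIV. cmod (a $ i) * norm x)"
    unfolding cdot_def
    by (intro sum_norm_le) (simp add: norm_mult mult_left_mono Finite_Cartesian_Product.norm_nth_le)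
  then show ?thesis by (simp add: sum_distrib_right)
qed

lemma inner_eq_Re_cdot: "inner a x = Re (cdot (\<chi> i. cnj (a $ i)) x)"
  by (simp add: inner_vec_def cdot_def inner_complex_def)

text \<open>A square matrix with rows \<open>u\<close>, \<open>w\<close> and otherwise zero has a
  zero row in dimension at least 3, hence a nontrivial kernel. This is where the dimension
  enters.\<close>

lemma exists_cdot_orthogonal:
  fixes u w :: "complex ^ 'n"
  assumes "CARD('n) \<ge> 3"
  obtains a where "a \<noteq> 0" "cdot a u = 0" "cdot a w = 0"
proof -
  obtain i j k :: 'n where ijk: "i \<noteq> j" "i \<noteq> k" "j \<noteq> k"
    using assms card_le_Suc_iff[of 2 "UNIV :: 'n set"]
    by (auto simp: numeral_eq_Suc card_le_Suc_iff)
  define A :: "complex ^ 'n ^ 'n" where "A = (\<chi> m. if m = i then u else if m = j then w else 0)"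
  have "row k A = 0"
    using ijk by (simp add: row_def A_def vec_eq_iff)
  then have "\<not> invertible A"
    by (simp add: invertible_det_nz det_zero_row)
  then obtain a where a: "A *v a = 0" "a \<noteq> 0"
    using invertible_left_inverse[of A] matrix_left_invertible_ker[of A] by blast
  have "(A *v a) $ i = cdot a u" "(A *v a) $ j = cdot a w"
    using ijk by (simp_all add: matrix_vector_mult_def A_def cdot_def mult.commute)
  with a that show thesis by simp
qed

text \<open>Some rotation gives \<open>\<beta>\<close> the argument of \<open>\<alpha>\<close>, and
  then the moduli add.\<close>

lemma cmod_add_le_of_rotations:
  assumes "\<And>\<xi>. cmod \<xi> = 1 \<Longrightarrow> cmod (\<alpha> + \<xi> * \<beta>) \<le> r"
  shows "cmod \<alpha> + cmod \<beta> \<le> r"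
proof -
  obtain s where s: "cmod s = 1" "\<alpha> = of_real (cmod \<alpha>) * s"
    by (metis norm_cis rcis_cmod_Arg rcis_def)
  obtain t where t: "cmod t = 1" "\<beta> = of_real (cmod \<beta>) * t"
    by (metis norm_cis rcis_cmod_Arg rcis_def)
  have "\<alpha> + (s / t) * \<beta> = of_real (cmod \<alpha> + cmod \<beta>) * s"
  proof -
    have "t \<noteq> 0" using t(1) by auto
    then have "(s / t) * (of_real (cmod \<beta>) * t) = of_real (cmod \<beta>) * s" by simp
    then show ?thesis using s(2) t(2) by (metis distrib_right of_real_add)
  qed
  then have "cmod (\<alpha> + (s / t) * \<beta>) = cmod \<alpha> + cmod \<beta>"
    using s(1) by (simp add: norm_mult del: of_real_add)
  with assms[of "s / t"] s(1) t(1) show ?thesis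
    by (simp add: norm_divide)
qed


section \<open>Symmetry through rotations, and images of the body under functionals\<close>

lemma circ_symmetric_rotate:
  assumes "circ_symmetric A"
  obtains c where "\<And>x \<xi>. x \<in> A \<Longrightarrow> cmod \<xi> = 1 \<Longrightarrow> c + \<xi> *s (x - c) \<in> A"
proof -
  obtain c where c: "\<And>\<xi>. cmod \<xi> = 1 \<Longrightarrow>
      (\<lambda>x. \<xi> *s x) ` ((\<lambda>x. x - c) ` A) = (\<lambda>x. x - c) ` A"
    using assms unfolding circ_symmetric_def by blast
  have "c + \<xi> *s (x - c) \<in> A" if "x \<in> A" "cmod \<xi> = 1" for x \<xi>
  proof -
    have "\<xi> *s (x - c) \<in> (\<lambda>x. x - c) ` A"
      using c[OF that(2)] that(1) by blast
    then show ?thesis by auto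
  qed
  with that show thesis by blast
qed

text \<open>Inclusions suffice, since the inverse rotation gives the reverse one.\<close>

lemma circ_symmetricI:
  fixes A :: "(complex ^ 'n) set"
  assumes rot: "\<And>x \<xi>. x \<in> A \<Longrightarrow> cmod \<xi> = 1 \<Longrightarrow> c + \<xi> *s (x - c) \<in> A"
  shows "circ_symmetric A"
  unfolding circ_symmetric_def
proof (intro exI[of _ c] allI impI equalityI subsetI)
  fix \<xi> :: complex and y
  assume \<xi>: "cmod \<xi> = 1"
  have rot': "\<zeta> *s (x - c) \<in> (\<lambda>x. x - c) ` A" if "x \<in> A" "cmod \<zeta> = 1" for \<zeta> x
    using rot[OF that] by (intro image_eqI[where x = "c + \<zeta> *s (x - c)"]) auto
  show "y \<in> (\<lambda>x. x - c) ` A" if "y \<in> (\<lambda>x. \<xi> *s x) ` ((\<lambda>x. x - c) ` A)"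
    using that rot'[OF _ \<xi>] by blast
  show "y \<in> (\<lambda>x. \<xi> *s x) ` ((\<lambda>x. x - c) ` A)" if "y \<in> (\<lambda>x. x - c) ` A"
  proof (rule image_eqI)
    show "y = \<xi> *s (inverse \<xi> *s y)"
      using \<xi> norm_zero[where 'a = complex] by (cases "\<xi> = 0") (auto simp: vector_smult_assoc)
    show "inverse \<xi> *s y \<in> (\<lambda>x. x - c) ` A"
      using that rot'[of _ "inverse \<xi>"] \<xi> by (auto simp: norm_inverse)
  qed
qed

text \<open>Let \<open>x\<close>, \<open>y\<close> realise the diameter \<open>W\<close> of the
  image and let \<open>c\<close> be the centre of a section containing both. Reflection in
  \<open>c\<close> keeps section points within \<open>W / 2\<close> of the centre under
  \<open>f\<close>, so \<open>x\<close> lies at exactly that distance and its rotations trace a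
  circle of radius \<open>W / 2\<close>. A point of \<open>K\<close> outside this circle would be
  farther than \<open>W\<close> from the opposite point of the circle.\<close>

lemma functional_image_disc:
  fixes K :: "(complex ^ 'n) set"
  assumes card: "CARD('n) \<ge> 3" and K: "compact K" "K \<noteq> {}"
    and sym: "\<And>H. complex_affine_hyperplane H \<Longrightarrow> x0 \<in> H \<Longrightarrow> circ_symmetric (H \<inter> K)"
  shows "\<exists>p v. (\<forall>\<xi>. cmod \<xi> = 1 \<longrightarrow> p + \<xi> *s v \<in> K) \<and> cdot f v = of_real (cmod (cdot f v))
      \<and> (\<forall>x\<in>K. cmod (cdot f x - cdot f p) \<le> cmod (cdot f v))"
proof -
  have "\<exists>q\<in>K \<times> K. \<forall>q'\<in>K \<times> K.
      cmod (cdot f (fst q') - cdot f (snd q')) \<le> cmod (cdot f (fst q) - cdot f (snd q))"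
    by (intro continuous_attains_sup compact_Times continuous_intros) (use K in auto)
  then obtain x y where xy: "x \<in> K" "y \<in> K"
    and max: "\<And>x' y'. x' \<in> K \<Longrightarrow> y' \<in> K \<Longrightarrow> cmod (cdot f x' - cdot f y') \<le> cmod (cdot f x - cdot f y)"
    by auto
  obtain a where a: "a \<noteq> 0" "cdot a (x - x0) = 0" "cdot a (y - x0) = 0"
    using exists_cdot_orthogonal[OF card] by blast
  define H where "H = {z. cdot a z = cdot a x0}"
  have "complex_affine_hyperplane H" "x0 \<in> H"
    using a(1) by (auto simp: complex_affine_hyperplane_def H_def cdot_def)
  then obtain c where c: "\<And>z \<xi>. z \<in> H \<inter> K \<Longrightarrow> cmod \<xi> = 1 \<Longrightarrow> c + \<xi> *s (z - c) \<in> H \<inter> K"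
    using circ_symmetric_rotate[OF sym] by blast
  have H: "x \<in> H \<inter> K" "y \<in> H \<inter> K"
    using a xy by (auto simp: H_def cdot_diff_right)
  define W where "W = cmod (cdot f x - cdot f y)"
  have half: "2 * cmod (cdot f (z - c)) \<le> W" if "z \<in> H \<inter> K" for z
  proof -
    have "cmod (cdot f z - cdot f (c + (-1) *s (z - c))) \<le> W"
      unfolding W_def using that c[OF that, of "-1"] by (intro max) auto
    also have "cdot f z - cdot f (c + (-1) *s (z - c)) = 2 * cdot f (z - c)"
      unfolding cdot_add_right cdot_smult_right cdot_diff_right by simp
    finally show ?thesis by (simp add: norm_mult)
  qed
  \<comment> \<open>The two distances to the centre add up to at least \<open>W\<close>, and neither
    exceeds \<open>W / 2\<close>.\<close>
  have "W \<le> cmod (cdot f (x - c)) + cmod (cdot f (y - c))"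
    using norm_triangle_ineq4[of "cdot f (x - c)" "cdot f (y - c)"] by (simp add: W_def cdot_diff_right)
  with half[OF H(1)] half[OF H(2)] have W: "W = 2 * cmod (cdot f (x - c))"
    by linarith
  obtain t where t: "cmod t = 1" "cdot f (x - c) = of_real (cmod (cdot f (x - c))) * t"
    by (metis norm_cis rcis_cmod_Arg rcis_def)
  \<comment> \<open>Removing the phase \<open>t\<close> makes \<open>cdot f v\<close> real and
    nonnegative; \<open>v\<close> parametrises the same circle.\<close>
  define v where "v = inverse t *s (x - c)"
  have cv: "c + \<xi> *s v \<in> K" if "cmod \<xi> = 1" for \<xi>
    using c[OF H(1), of "\<xi> * inverse t"] that t(1)
    by (simp add: v_def vector_smult_assoc norm_mult norm_inverse)
  have "t \<noteq> 0" using t(1) by auto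
  then have fv: "cdot f v = of_real (cmod (cdot f (x - c)))"
    using t(2) unfolding v_def cdot_smult_right
    by (metis mult.commute mult.left_commute mult_1_right left_inverse)
  then have cfv: "cmod (cdot f v) = cmod (cdot f (x - c))"
    by simp
  have "cmod (cdot f z - cdot f c) \<le> cmod (cdot f v)" if "z \<in> K" for z
  proof -
    have "cmod (cdot f z - cdot f c) + cmod (cdot f v) \<le> W"
    proof (rule cmod_add_le_of_rotations)
      fix \<xi> :: complex assume "cmod \<xi> = 1"
      then have "c + (- \<xi>) *s v \<in> K" by (intro cv) simp
      then have "cmod (cdot f z - cdot f (c + (- \<xi>) *s v)) \<le> W"
        unfolding W_def using that by (intro max)
      then show "cmod (cdot f z - cdot f c + \<xi> * cdot f v) \<le> W"
        unfolding cdot_add_right cdot_smult_right by (simp add: algebra_simps)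
    qed
    then show ?thesis using W cfv by simp
  qed
  then show ?thesis using cv fv cfv by (intro exI[of _ c] exI[of _ v]) auto
qed

section \<open>Linearity of the centre and symmetry of the body\<close>

theorem theorem2p4:
  fixes K :: "(complex ^ 'n) set" and x0 :: "complex ^ 'n"
  assumes "CARD('n) \<ge> 3"
    and "convex_body K"
    and "x0 \<in> interior K"
    and "\<And>H. complex_affine_hyperplane H \<Longrightarrow> x0 \<in> H \<Longrightarrow> circ_symmetric (H \<inter> K)"
  shows "circ_symmetric K"
proof -
  have K: "compact K" "convex K" "K \<noteq> {}"
    using assms(2,3) interior_subset by (auto simp: convex_body_def)
  obtain P V where PV: "\<And>f \<xi>. cmod \<xi> = 1 \<Longrightarrow> P f + \<xi> *s V f \<in> K"
    and fV: "\<And>f. cdot f (V f) = of_real (cmod (cdot f (V f)))"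
    and disc: "\<And>f x. x \<in> K \<Longrightarrow> cmod (cdot f x - cdot f (P f)) \<le> cmod (cdot f (V f))"
    using functional_image_disc[OF assms(1) K(1,3) assms(4)] by metis
  define g where "g f = cdot f (P f)" for f
  define r where "r f = cmod (cdot f (V f))" for f
  \<comment> \<open>The circle belonging to \<open>f\<close> lies in \<open>K\<close>, so its image
    under \<open>k\<close> lies in the disc of \<open>k\<close>.\<close>
  have key: "cmod (cdot k (P f) - g k) + cmod (cdot k (V f)) \<le> r k" for k f
  proof (rule cmod_add_le_of_rotations)
    fix \<xi> :: complex assume "cmod \<xi> = 1"
    from disc[OF PV[OF this]] show "cmod (cdot k (P f) - g k + \<xi> * cdot k (V f)) \<le> r k"
      by (simp add: g_def r_def cdot_add_right cdot_smult_right algebra_simps)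
  qed
  have r_le: "r (l *s k) \<le> cmod l * r k" for l k
  proof -
    have "cmod (cdot k (V (l *s k))) \<le> r k"
      using key[of k "l *s k"] by (smt (verit) norm_ge_zero)
    then show ?thesis
      by (simp add: r_def cdot_smult_left norm_mult mult_left_mono)
  qed
  \<comment> \<open>Homogeneity of \<open>r\<close> makes \<open>cmod (cdot k (V (l *s k)))\<close>
    at least \<open>r k\<close>, so \<open>key\<close> leaves no room for the centres to
    differ.\<close>
  have g_smult: "g (l *s k) = l * g k" for l k
  proof (cases "l = 0")
    case False
    have "r k \<le> inverse (cmod l) * r (l *s k)"
      using r_le[of "inverse l" "l *s k"] False by (simp add: vector_smult_assoc norm_inverse)
    then have "r k \<le> cmod (cdot k (V (l *s k)))"
      using False by (simp add: r_def cdot_smult_left norm_mult flip: mult.assoc)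
    with key[of k "l *s k"] have "cmod (cdot k (P (l *s k)) - g k) \<le> 0"
      by linarith
    then have "cdot k (P (l *s k)) = g k" by simp
    then show ?thesis by (simp add: g_def cdot_smult_left)
  qed (simp add: g_def cdot_smult_left)
  obtain B where B: "\<And>x. x \<in> K \<Longrightarrow> norm x \<le> B"
    using compact_imp_bounded[OF K(1)] bounded_iff by blast
  \<comment> \<open>\<open>P f\<close> and \<open>V f\<close> are half the sum and half the
    difference of the points \<open>P f + V f\<close> and \<open>P f - V f\<close> of
    \<open>K\<close>.\<close>
  have nP: "norm (P f) \<le> B" and nV: "norm (V f) \<le> B" for f
  proof -
    have in_K: "norm (P f + V f) \<le> B" "norm (P f - V f) \<le> B"
      using B[OF PV[of 1 f]] B[OF PV[of "-1" f]] by (simp_all add: vector_sneg_minus1[symmetric])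
    have "2 *\<^sub>R P f = (P f + V f) + (P f - V f)" "2 *\<^sub>R V f = (P f + V f) - (P f - V f)"
      by (simp_all add: scaleR_2)
    then have "norm (2 *\<^sub>R P f) \<le> B + B" "norm (2 *\<^sub>R V f) \<le> B + B"
      using in_K by (metis norm_triangle_mono, metis norm_triangle_le_diff add_mono)
    then show "norm (P f) \<le> B" "norm (V f) \<le> B" by simp_all
  qed
  have affine: "\<exists>\<beta>. \<forall>z. g (f1 + z *s f2) = g f1 + z * \<beta>" for f1 f2
  proof -
    define M where "M = (\<Sum>i\<in>UNIV. cmod (f2 $ i)) * B"
    have M: "cmod (cdot f2 x) \<le> M" if "norm x \<le> B" for x
      unfolding M_def by (rule order_trans[OF cmod_cdot_le mult_left_mono[OF that]]) (simp add: sum_nonneg)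
    \<comment> \<open>\<open>control\<close> is \<open>key\<close> for two functionals on the line.
      As \<open>cdot ?f (V ?f)\<close> equals the real number \<open>r ?f\<close>, the real part of
      \<open>cdot ?k (V ?f)\<close> is the supporting affine function of \<open>r\<close>.\<close>
    interpret convex_controlled "\<lambda>z. g (f1 + z *s f2)" "\<lambda>z. cdot f2 (P (f1 + z *s f2))"
      "\<lambda>z. cdot f2 (V (f1 + z *s f2))" "\<lambda>z. r (f1 + z *s f2)" M
    proof
      fix z w :: complex
      let ?f = "f1 + z *s f2" and ?k = "f1 + w *s f2"
      have k: "cdot ?k x = cdot ?f x + (w - z) * cdot f2 x" for x
        by (simp add: cdot_add_left cdot_smult_left algebra_simps)
      have "Re (cdot ?k (V ?f)) = r ?f + Re ((w - z) * cdot f2 (V ?f))"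
        unfolding k r_def using fV[of ?f] by (metis Re_complex_of_real plus_complex.sel(1))
      then have "r ?f + Re ((w - z) * cdot f2 (V ?f)) \<le> cmod (cdot ?k (V ?f))"
        using complex_Re_le_cmod by metis
      moreover have "cmod (g ?k - g ?f - (w - z) * cdot f2 (P ?f)) = cmod (cdot ?k (P ?f) - g ?k)"
        unfolding k g_def[of ?f] by (subst norm_minus_commute) (simp add: algebra_simps)
      ultimately show "cmod (g ?k - g ?f - (w - z) * cdot f2 (P ?f))
          \<le> r ?k - r ?f - Re ((w - z) * cdot f2 (V ?f))"
        using key[of ?k ?f] by linarith
    qed (use M nP nV in auto)
    \<comment> \<open>Here \<open>affine\<close> is the fact of the interpreted locale.\<close>
    show ?thesis using affine by simp
  qed
  \<comment> \<open>The slope \<open>\<beta>\<close> might depend on \<open>f1\<close>. Expanding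
    \<open>f1 + f2\<close> and \<open>f1 - f2\<close> from both ends, with \<open>g_smult\<close>
    for the factor -1, forces it to be \<open>g f2\<close>.\<close>
  have g_add: "g (f1 + f2) = g f1 + g f2" for f1 f2
  proof -
    obtain \<beta> where \<beta>: "\<And>z. g (f1 + z *s f2) = g f1 + z * \<beta>" using affine by blast
    obtain \<gamma> where \<gamma>: "\<And>z. g (f2 + z *s f1) = g f2 + z * \<gamma>" using affine by blast
    have "g f1 + \<beta> = g f2 + \<gamma>"
      using \<beta>[of 1] \<gamma>[of 1] by (simp add: add.commute)
    moreover have "g f1 - \<beta> = - (g f2 - \<gamma>)"
    proof -
      have "f1 + (-1) *s f2 = (-1) *s (f2 + (-1) *s f1)"
        by (simp add: vec_eq_iff)
      then have "g (f1 + (-1) *s f2) = (-1) * g (f2 + (-1) *s f1)"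
        by (simp only: g_smult)
      then show ?thesis unfolding \<beta> \<gamma> by simp
    qed
    ultimately have "2 * \<beta> = 2 * g f2" by algebra
    then have "\<beta> = g f2" by simp
    then show ?thesis using \<beta>[of 1] by simp
  qed
  \<comment> \<open>\<open>axis i 1\<close>, read as a functional, is the \<open>i\<close>-th
    coordinate, so linearity leaves no other choice of \<open>c\<close>.\<close>
  define c where "c = (\<chi> i. g (axis i 1))"
  have gc: "g f = cdot f c" for f
  proof -
    have g_sum: "g (\<Sum>i\<in>I. F i) = (\<Sum>i\<in>I. g (F i))" if "finite I" for I :: "'n set" and F
      using that by induction (auto simp: g_add, simp add: g_def)
    have "f = (\<Sum>i\<in>UNIV. f $ i *s axis i 1)"
      by (simp add: basis_expansion)
    then have "g f = (\<Sum>i\<in>UNIV. f $ i * g (axis i 1))"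
      by (metis (no_types, lifting) g_sum finite_class.finite_UNIV g_smult sum.cong)
    then show ?thesis by (simp add: c_def cdot_def)
  qed
  show ?thesis
  proof (rule circ_symmetricI)
    fix x and \<xi> :: complex assume x: "x \<in> K" and \<xi>: "cmod \<xi> = 1"
    let ?y = "c + \<xi> *s (x - c)"
    show "?y \<in> K"
    proof (rule ccontr)
      assume "?y \<notin> K"
      then obtain b d where b: "inner b ?y < d" "\<And>z. z \<in> K \<Longrightarrow> d < inner b z"
        using separating_hyperplane_closed_point[OF K(2) compact_imp_closed[OF K(1)]] by blast
      define f where "f = (\<chi> i. cnj (b $ i))"
      \<comment> \<open>At this point the real part of \<open>f\<close> is
        \<open>Re (cdot f c) - r f\<close>, the least value on the disc. Rotation about
        \<open>c\<close> keeps the image of \<open>x\<close> in that disc, so \<open>?y\<close>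
        cannot be strictly separated from \<open>K\<close>.\<close>
      have "P f + (-1) *s V f \<in> K" by (rule PV) simp
      from b(2)[OF this] have "d < Re (cdot f (P f - V f))"
        by (simp add: inner_eq_Re_cdot f_def)
      moreover have "Re (cdot f (V f)) = r f"
        using fV[of f] unfolding r_def by (metis Re_complex_of_real)
      ultimately have "d < Re (cdot f c) - r f"
        using gc[of f] by (simp add: g_def cdot_diff_right)
      moreover have "Re (cdot f ?y) < d" using b(1) by (simp add: inner_eq_Re_cdot f_def)
      moreover have "cmod (\<xi> * (cdot f x - cdot f c)) \<le> r f"
        using disc[OF x, of f] \<xi> gc[of f] by (simp add: norm_mult g_def r_def)
      moreover have "Re (cdot f ?y) = Re (cdot f c) + Re (\<xi> * (cdot f x - cdot f c))"
        by (simp add: cdot_add_right cdot_smult_right cdot_diff_right algebra_simps)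
      moreover have "- cmod (\<xi> * (cdot f x - cdot f c)) \<le> Re (\<xi> * (cdot f x - cdot f c))"
        using abs_Re_le_cmod[of "\<xi> * (cdot f x - cdot f c)"] by linarith
      ultimately show False by linarith
    qed
  qed
qed

end
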